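(* Let $Y\in\mathbb{V}(X)$, let $\phi(x_1,\dots,x_n,y_1,\dots,y_m)$ be a totally open formula and, for $i=1,\dots,m$, let $S_i\in\mathbb{V}(X)$ and $Q_i\in\{\exists,\forall\}$. The following are equivalent: (1) the formula $\exists x_1\dots\exists x_n\,Q_1y_1\in S_1\dots Q_my_m\in S_m\,\phi(x_1,\dots,x_n,y_1,\dots,y_m)$ is partition regular on $Y$; (2) there exist $\alpha_1,\dots,\alpha_n\in{}^{\ast}Y$ that all generate the same ultrafilter on $Y$ (i.e. $\mathfrak{U}_{\alpha_1}=\dots=\mathfrak{U}_{\alpha_n}$) such that $Q_1y_1\in{}^{\ast}S_1\dots Q_my_m\in{}^{\ast}S_m\ {}^{\ast}\phi(\alpha_1,\dots,\alpha_n,y_1,\dots,y_m)$ holds; (3) there exists an ultrafilter $\mathcal{U}$ on $Y$ such that every $A\in\mathcal{U}$ models $\exists x_1\dots\exists x_n\,Q_1y_1\in S_1\dots Q_my_m\in S_m\,\phi$.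
   Context: Work in a single superstructure model $\langle\mathbb{V}(X),\mathbb{V}(X),\ast\rangle$ of nonstandard methods ($X$ infinite, $\ast$ a star map on $\mathbb{V}(X)$ satisfying transfer), assumed to have the $\kappa$-enlarging property for a sufficiently large $\kappa$ (e.g. $\kappa>|\mathcal{P}(\mathcal{P}(Y))|$). Formulas are first-order formulas with bounded quantifiers in the language of $\mathbb{V}(X)$; $\phi(x_1,\dots,x_n,y_1,\dots,y_m)$ means its variables are exactly these, and it is totally open if all its variables are free. For $\alpha\in{}^{\ast}Y$, $\mathfrak{U}_\alpha=\{A\subseteq Y\mid\alpha\in{}^{\ast}A\}$. A set $A\subseteq Y$ models $\exists x_1\dots\exists x_n\,Q_1y_1\in S_1\dots Q_my_m\in S_m\,\phi$ if there are $x_1,\dots,x_n\in A$ with $Q_1y_1\in S_1\dots Q_my_m\in S_m\,\phi(x_1,\dots,x_n,y_1,\dots,y_m)$ true. Such a formula is partition regular on $Y$ if for every $k\in\mathbb{N}$ and every partition $Y=A_1\cup\dots\cup A_k$ some $A_i$ models it. *)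

theory Defs
  imports Main "HOL-Library.Disjoint_Sets"
begin

unbundle cardinal_syntax

text \<open>
  HOL cannot build the union of all finite iterated power sets of an infinite type, so a
  superstructure is given up to isomorphism: the type \<open>'v\<close> is the universe, \<open>elts a\<close> is the set
  of elements of \<open>a\<close>, and \<open>X\<close> is the set of atoms. Subsets of a member \<open>Y\<close> of the universe are
  handled as HOL subsets of \<open>elts Y\<close>; \<open>vset elts X A\<close> is the member of the universe with
  extension \<open>A\<close>.
\<close>

fun level :: "('v \<Rightarrow> 'v set) \<Rightarrow> 'v set \<Rightarrow> nat \<Rightarrow> 'v set" where
  "level elts X 0 = X"
| "level elts X (Suc n) = level elts X n \<union> {a. a \<notin> X \<and> elts a \<subseteq> level elts X n}"

definition superstructure :: "('v \<Rightarrow> 'v set) \<Rightarrow> 'v set \<Rightarrow> bool" where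
  "superstructure elts X \<longleftrightarrow>
     (\<forall>x\<in>X. elts x = {}) \<and>
     inj_on elts (- X) \<and>
     (\<forall>n. \<forall>A \<subseteq> level elts X n. \<exists>a. a \<notin> X \<and> elts a = A) \<and>
     (\<Union>n. level elts X n) = UNIV"

definition vset :: "('v \<Rightarrow> 'v set) \<Rightarrow> 'v set \<Rightarrow> 'v set \<Rightarrow> 'v" where
  "vset elts X A = (THE a. a \<notin> X \<and> elts a = A)"

definition opair :: "('v \<Rightarrow> 'v set) \<Rightarrow> 'v set \<Rightarrow> 'v \<Rightarrow> 'v \<Rightarrow> 'v" where
  "opair elts X a b = vset elts X {vset elts X {a}, vset elts X {a, b}}"

text \<open>
  Formulas have parameters from the universe. Ordered-pair terms make relations available in
  quantifier-free formulas: \<open>R(s, t)\<close> is \<open>Mem (TPair s t) (Const R)\<close>, and \<open>f(s) = t\<close> is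
  \<open>Mem (TPair s t) (Const f)\<close>.
\<close>

datatype 'v tm = Var nat | Const 'v | TPair "'v tm" "'v tm"

datatype 'v fm =
    Mem "'v tm" "'v tm"
  | Equ "'v tm" "'v tm"
  | Neg "'v fm"
  | Conj "'v fm" "'v fm"
  | Disj "'v fm" "'v fm"
  | Imp "'v fm" "'v fm"
  | BAll nat "'v tm" "'v fm"
  | BEx nat "'v tm" "'v fm"

fun tm_vars :: "'v tm \<Rightarrow> nat set" where
  "tm_vars (Var v) = {v}"
| "tm_vars (Const c) = {}"
| "tm_vars (TPair s t) = tm_vars s \<union> tm_vars t"

fun fm_vars :: "'v fm \<Rightarrow> nat set" where
  "fm_vars (Mem s t) = tm_vars s \<union> tm_vars t"
| "fm_vars (Equ s t) = tm_vars s \<union> tm_vars t"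
| "fm_vars (Neg \<phi>) = fm_vars \<phi>"
| "fm_vars (Conj \<phi> \<psi>) = fm_vars \<phi> \<union> fm_vars \<psi>"
| "fm_vars (Disj \<phi> \<psi>) = fm_vars \<phi> \<union> fm_vars \<psi>"
| "fm_vars (Imp \<phi> \<psi>) = fm_vars \<phi> \<union> fm_vars \<psi>"
| "fm_vars (BAll v t \<phi>) = insert v (tm_vars t \<union> fm_vars \<phi>)"
| "fm_vars (BEx v t \<phi>) = insert v (tm_vars t \<union> fm_vars \<phi>)"

fun free_vars :: "'v fm \<Rightarrow> nat set" where
  "free_vars (Mem s t) = tm_vars s \<union> tm_vars t"
| "free_vars (Equ s t) = tm_vars s \<union> tm_vars t"
| "free_vars (Neg \<phi>) = free_vars \<phi>"
| "free_vars (Conj \<phi> \<psi>) = free_vars \<phi> \<union> free_vars \<psi>"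
| "free_vars (Disj \<phi> \<psi>) = free_vars \<phi> \<union> free_vars \<psi>"
| "free_vars (Imp \<phi> \<psi>) = free_vars \<phi> \<union> free_vars \<psi>"
| "free_vars (BAll v t \<phi>) = tm_vars t \<union> (free_vars \<phi> - {v})"
| "free_vars (BEx v t \<phi>) = tm_vars t \<union> (free_vars \<phi> - {v})"

definition totally_open :: "'v fm \<Rightarrow> bool" where
  "totally_open \<phi> \<longleftrightarrow> fm_vars \<phi> = free_vars \<phi>"

fun eval :: "('v \<Rightarrow> 'v set) \<Rightarrow> 'v set \<Rightarrow> (nat \<Rightarrow> 'v) \<Rightarrow> 'v tm \<Rightarrow> 'v" where
  "eval elts X e (Var v) = e v"
| "eval elts X e (Const c) = c"
| "eval elts X e (TPair s t) = opair elts X (eval elts X e s) (eval elts X e t)"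

fun sat :: "('v \<Rightarrow> 'v set) \<Rightarrow> 'v set \<Rightarrow> (nat \<Rightarrow> 'v) \<Rightarrow> 'v fm \<Rightarrow> bool" where
  "sat elts X e (Mem s t) \<longleftrightarrow> eval elts X e s \<in> elts (eval elts X e t)"
| "sat elts X e (Equ s t) \<longleftrightarrow> eval elts X e s = eval elts X e t"
| "sat elts X e (Neg \<phi>) \<longleftrightarrow> \<not> sat elts X e \<phi>"
| "sat elts X e (Conj \<phi> \<psi>) \<longleftrightarrow> sat elts X e \<phi> \<and> sat elts X e \<psi>"
| "sat elts X e (Disj \<phi> \<psi>) \<longleftrightarrow> sat elts X e \<phi> \<or> sat elts X e \<psi>"
| "sat elts X e (Imp \<phi> \<psi>) \<longleftrightarrow> (sat elts X e \<phi> \<longrightarrow> sat elts X e \<psi>)"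
| "sat elts X e (BAll v t \<phi>) \<longleftrightarrow> (\<forall>a \<in> elts (eval elts X e t). sat elts X (e(v := a)) \<phi>)"
| "sat elts X e (BEx v t \<phi>) \<longleftrightarrow> (\<exists>a \<in> elts (eval elts X e t). sat elts X (e(v := a)) \<phi>)"

text \<open>
  The star transform \<open>*\<phi>\<close> of \<open>\<phi>\<close> is \<open>map_fm star \<phi>\<close>: every parameter \<open>c\<close> is replaced by \<open>*c\<close>.
\<close>

definition transfer :: "('v \<Rightarrow> 'v set) \<Rightarrow> 'v set \<Rightarrow> ('v \<Rightarrow> 'v) \<Rightarrow> bool" where
  "transfer elts X star \<longleftrightarrow>
     (\<forall>\<phi> e. sat elts X e \<phi> \<longleftrightarrow> sat elts X (star \<circ> e) (map_fm star \<phi>))"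

definition nonstandard_model :: "('v \<Rightarrow> 'v set) \<Rightarrow> 'v set \<Rightarrow> ('v \<Rightarrow> 'v) \<Rightarrow> bool" where
  "nonstandard_model elts X star \<longleftrightarrow>
     superstructure elts X \<and> infinite X \<and> transfer elts X star"

definition enlarging :: "('v \<Rightarrow> 'v set) \<Rightarrow> ('v \<Rightarrow> 'v) \<Rightarrow> 'k rel \<Rightarrow> bool" where
  "enlarging elts star \<kappa> \<longleftrightarrow>
     (\<forall>\<F>. |\<F>| <o \<kappa> \<and> (\<forall>\<G> \<subseteq> \<F>. finite \<G> \<longrightarrow> (\<exists>a. \<forall>A\<in>\<G>. a \<in> elts A)) \<longrightarrow>
          (\<exists>a. \<forall>A\<in>\<F>. a \<in> elts (star A)))"

definition ultrafilter_on :: "'a set \<Rightarrow> 'a set set \<Rightarrow> bool" where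
  "ultrafilter_on Y \<U> \<longleftrightarrow>
     \<U> \<subseteq> Pow Y \<and> Y \<in> \<U> \<and> {} \<notin> \<U> \<and>
     (\<forall>A\<in>\<U>. \<forall>B\<in>\<U>. A \<inter> B \<in> \<U>) \<and>
     (\<forall>A\<in>\<U>. \<forall>B. A \<subseteq> B \<and> B \<subseteq> Y \<longrightarrow> B \<in> \<U>) \<and>
     (\<forall>A. A \<subseteq> Y \<longrightarrow> A \<in> \<U> \<or> Y - A \<in> \<U>)"

definition generated_ultrafilter ::
    "('v \<Rightarrow> 'v set) \<Rightarrow> 'v set \<Rightarrow> ('v \<Rightarrow> 'v) \<Rightarrow> 'v \<Rightarrow> 'v \<Rightarrow> 'v set set" where
  "generated_ultrafilter elts X star Y \<alpha> =
     {A. A \<subseteq> elts Y \<and> \<alpha> \<in> elts (star (vset elts X A))}"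

datatype quant = Exists | Forall

fun quant_prefix :: "quant list \<Rightarrow> nat list \<Rightarrow> 'v list \<Rightarrow> 'v fm \<Rightarrow> 'v fm" where
  "quant_prefix (Exists # Qs) (y # ys) (S # Ss) \<phi> = BEx y (Const S) (quant_prefix Qs ys Ss \<phi>)"
| "quant_prefix (Forall # Qs) (y # ys) (S # Ss) \<phi> = BAll y (Const S) (quant_prefix Qs ys Ss \<phi>)"
| "quant_prefix _ _ _ \<phi> = \<phi>"

text \<open>
  The unbounded existential block over the variables \<open>xs\<close> is given separately from its matrix
  \<open>\<psi>\<close>: \<open>models elts X A xs \<psi>\<close> says that \<open>A\<close> models \<open>\<exists>xs. \<psi>\<close>. The values of the assignment
  outside \<open>xs\<close> are irrelevant when \<open>free_vars \<psi> \<subseteq> set xs\<close>.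
\<close>

definition models ::
    "('v \<Rightarrow> 'v set) \<Rightarrow> 'v set \<Rightarrow> 'v set \<Rightarrow> nat list \<Rightarrow> 'v fm \<Rightarrow> bool" where
  "models elts X A xs \<psi> \<longleftrightarrow> (\<exists>e. (\<forall>x\<in>set xs. e x \<in> A) \<and> sat elts X e \<psi>)"

definition partition_regular ::
    "('v \<Rightarrow> 'v set) \<Rightarrow> 'v set \<Rightarrow> 'v \<Rightarrow> nat list \<Rightarrow> 'v fm \<Rightarrow> bool" where
  "partition_regular elts X Y xs \<psi> \<longleftrightarrow>
     (\<forall>P. finite P \<and> partition_on (elts Y) P \<longrightarrow> (\<exists>A\<in>P. models elts X A xs \<psi>))"

end

theory Submission imports Defs begin

text \<open>
  Replacing the block \<open>Q\<^sub>1y\<^sub>1\<in>S\<^sub>1 \<dots> Q\<^sub>my\<^sub>m\<in>S\<^sub>m \<phi>\<close> by an arbitrary formula \<open>\<psi>\<close> whose free variables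
  are among \<open>xs\<close>, transfer says that \<open>A\<close> models \<open>\<exists>xs. \<psi>\<close> iff \<open>*A\<close> models \<open>\<exists>xs. *\<psi>\<close>; so if all
  \<open>\<alpha>\<^sub>i\<close> generate \<open>\<U>\<close> and satisfy \<open>*\<psi>\<close>, every member of \<open>\<U>\<close> models \<open>\<exists>xs. \<psi>\<close>. Conversely, for
  such an ultrafilter \<open>\<U>\<close> the sets of (codes of) tuples from \<open>A \<in> \<U>\<close> satisfying \<open>\<psi>\<close> have the finite
  intersection property, and enlarging yields one tuple in all their star extensions.
  If \<open>\<exists>xs. \<psi>\<close> is partition regular, the complements of the sets that do not model it have the
  finite intersection property, and a point in all their star extensions generates an ultrafilter
  consisting of sets that do model it.
\<close>

section \<open>Free variables and star transforms of formulas\<close>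

lemma eval_cong:
  "(\<And>v. v \<in> tm_vars t \<Longrightarrow> e v = e' v) \<Longrightarrow> eval elts X e t = eval elts X e' t"
  by (induction t) auto

lemma sat_cong:
  "(\<And>v. v \<in> free_vars \<psi> \<Longrightarrow> e v = e' v) \<Longrightarrow> sat elts X e \<psi> \<longleftrightarrow> sat elts X e' \<psi>"
proof (induction \<psi> arbitrary: e e')
  case (Mem s t)
  then show ?case using eval_cong[of s e e'] eval_cong[of t e e'] by simp
next
  case (Equ s t)
  then show ?case using eval_cong[of s e e'] eval_cong[of t e e'] by simp
next
  case (Neg \<psi>)
  then show ?case by (metis free_vars.simps(3) sat.simps(3))
next
  case (Conj \<psi> \<chi>)
  then show ?case by (metis UnCI free_vars.simps(4) sat.simps(4))
next
  case (Disj \<psi> \<chi>)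
  then show ?case by (metis UnCI free_vars.simps(5) sat.simps(5))
next
  case (Imp \<psi> \<chi>)
  then show ?case by (metis UnCI free_vars.simps(6) sat.simps(6))
next
  case (BAll v t \<psi>)
  have "eval elts X e t = eval elts X e' t"
    using BAll.prems by (intro eval_cong) simp
  moreover have "sat elts X (e(v := a)) \<psi> \<longleftrightarrow> sat elts X (e'(v := a)) \<psi>" for a
    using BAll.prems by (intro BAll.IH) auto
  ultimately show ?case by simp
next
  case (BEx v t \<psi>)
  have "eval elts X e t = eval elts X e' t"
    using BEx.prems by (intro eval_cong) simp
  moreover have "sat elts X (e(v := a)) \<psi> \<longleftrightarrow> sat elts X (e'(v := a)) \<psi>" for a
    using BEx.prems by (intro BEx.IH) auto
  ultimately show ?case by simp
qed

lemma tm_vars_map: "tm_vars (map_tm f t) = tm_vars t"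
  by (induction t) auto

lemma free_vars_map: "free_vars (map_fm f \<psi>) = free_vars \<psi>"
  by (induction \<psi>) (auto simp: tm_vars_map)

lemma free_vars_subset_fm_vars: "free_vars \<psi> \<subseteq> fm_vars \<psi>"
  by (induction \<psi>) auto

lemma map_quant_prefix:
  "map_fm f (quant_prefix Qs ys Ss \<psi>) = quant_prefix Qs ys (map f Ss) (map_fm f \<psi>)"
  by (induction Qs ys Ss \<psi> rule: quant_prefix.induct) auto

text \<open>\<open>quant_prefix\<close> stops as soon as one of its lists ends; equal lengths ensure
  that every variable of \<open>ys\<close> gets bound.\<close>

lemma free_vars_quant_prefix:
  assumes "length Qs = length ys" and "length Ss = length ys"
  shows "free_vars (quant_prefix Qs ys Ss \<psi>) = free_vars \<psi> - set ys"
  using assms by (induction Qs ys Ss \<psi> rule: quant_prefix.induct) auto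

section \<open>Bounded existential blocks and codes of tuples\<close>

definition bex_list :: "nat list \<Rightarrow> 'v tm \<Rightarrow> 'v fm \<Rightarrow> 'v fm" where
  "bex_list xs t \<psi> = foldr (\<lambda>x. BEx x t) xs \<psi>"

lemma map_bex_list: "map_fm f (bex_list xs t \<psi>) = bex_list xs (map_tm f t) (map_fm f \<psi>)"
  by (induction xs) (auto simp: bex_list_def)

lemma sat_bex_list:
  "sat elts X e (bex_list xs (Const S) \<psi>) \<longleftrightarrow>
     (\<exists>e'. (\<forall>x\<in>set xs. e' x \<in> elts S) \<and> (\<forall>x. x \<notin> set xs \<longrightarrow> e' x = e x) \<and> sat elts X e' \<psi>)"
proof (induction xs arbitrary: e)
  case Nil
  have "(\<forall>x. e' x = e x) \<longleftrightarrow> e' = e" for e' by auto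
  then show ?case by (simp add: bex_list_def)
next
  case (Cons y xs)
  have "sat elts X e (bex_list (y # xs) (Const S) \<psi>) \<longleftrightarrow>
      (\<exists>a\<in>elts S. sat elts X (e(y := a)) (bex_list xs (Const S) \<psi>))"
    by (simp add: bex_list_def)
  also have "\<dots> \<longleftrightarrow> (\<exists>a\<in>elts S. \<exists>e'. (\<forall>x\<in>set xs. e' x \<in> elts S) \<and>
      (\<forall>x. x \<notin> set xs \<longrightarrow> e' x = (e(y := a)) x) \<and> sat elts X e' \<psi>)"
    by (simp only: Cons.IH)
  also have "\<dots> \<longleftrightarrow> (\<exists>e'. (\<forall>x\<in>set (y # xs). e' x \<in> elts S) \<and>
      (\<forall>x. x \<notin> set (y # xs) \<longrightarrow> e' x = e x) \<and> sat elts X e' \<psi>)" (is "?L \<longleftrightarrow> ?R")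
  proof
    assume ?L
    then obtain a e' where e': "a \<in> elts S" "\<forall>x\<in>set xs. e' x \<in> elts S"
      "\<forall>x. x \<notin> set xs \<longrightarrow> e' x = (e(y := a)) x" "sat elts X e' \<psi>" by blast
    \<comment> \<open>If \<open>y\<close> is quantified again further inside, the inner value wins
      and lies in \<open>elts S\<close> as well; otherwise \<open>e' y\<close> is
      \<open>a\<close>.\<close>
    then have "e' y \<in> elts S" by (cases "y \<in> set xs") auto
    with e' show ?R by (intro exI[of _ e']) auto
  next
    assume ?R
    then obtain e' where "\<forall>x\<in>set (y # xs). e' x \<in> elts S"
      "\<forall>x. x \<notin> set (y # xs) \<longrightarrow> e' x = e x" "sat elts X e' \<psi>" by blast
    then show ?L by (intro bexI[of _ "e' y"] exI[of _ e']) auto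
  qed
  finally show ?case .
qed

text \<open>Turns the unbounded existential block into a formula of the language, to which transfer
  applies. As \<open>\<psi>\<close> sees only \<open>xs\<close>, the assignment \<open>e\<close> may
  be arbitrary.\<close>

lemma models_iff_sat_bex_list:
  assumes "free_vars \<psi> \<subseteq> set xs"
  shows "models elts X (elts S) xs \<psi> \<longleftrightarrow> sat elts X e (bex_list xs (Const S) \<psi>)"
proof
  assume "models elts X (elts S) xs \<psi>"
  then obtain e' where e': "\<forall>x\<in>set xs. e' x \<in> elts S" "sat elts X e' \<psi>"
    unfolding models_def by blast
  \<comment> \<open>The witness must agree with \<open>e\<close> outside \<open>xs\<close>, where
    the values of \<open>e'\<close> do not affect \<open>\<psi>\<close>.\<close>
  have "sat elts X (override_on e e' (set xs)) \<psi>"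
    using e'(2) assms by (subst sat_cong[of _ _ e']) (auto simp: override_on_def)
  with e'(1) show "sat elts X e (bex_list xs (Const S) \<psi>)"
    unfolding sat_bex_list by (intro exI[of _ "override_on e e' (set xs)"]) auto
next
  assume "sat elts X e (bex_list xs (Const S) \<psi>)"
  then show "models elts X (elts S) xs \<psi>"
    unfolding sat_bex_list models_def by blast
qed

lemma models_mono: "models elts X A xs \<psi> \<Longrightarrow> A \<subseteq> B \<Longrightarrow> models elts X B xs \<psi>"
  unfolding models_def by blast

text \<open>Tuples are coded by nested pairs, so that the single point provided by enlarging carries
  all coordinates at once. The end marker \<open>c\<close> is arbitrary; as a parameter it is
  starred too.\<close>

definition tuple_tm :: "'v \<Rightarrow> nat list \<Rightarrow> 'v tm" where
  "tuple_tm c xs = foldr (\<lambda>x. TPair (Var x)) xs (Const c)"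

lemma tuple_tm_simps [simp]:
  "tuple_tm c [] = Const c" "tuple_tm c (x # xs) = TPair (Var x) (tuple_tm c xs)"
  by (simp_all add: tuple_tm_def)

lemma map_tuple_tm: "map_tm f (tuple_tm c xs) = tuple_tm (f c) xs"
  by (induction xs) auto

lemma tm_vars_tuple_tm: "tm_vars (tuple_tm c xs) = set xs"
  by (induction xs) auto

section \<open>Finite partitions and ultrafilters\<close>

lemma partition_on_fibres: "partition_on A ((\<lambda>s. {x \<in> A. f x = s}) ` f ` A)"
  by (auto simp: partition_on_def disjoint_def)

lemma ultrafilter_onD:
  assumes "ultrafilter_on Y \<U>"
  shows ultrafilter_on_subset: "A \<in> \<U> \<Longrightarrow> A \<subseteq> Y"
    and ultrafilter_on_top: "Y \<in> \<U>"
    and ultrafilter_on_nonempty: "{} \<notin> \<U>"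
    and ultrafilter_on_Int: "A \<in> \<U> \<Longrightarrow> B \<in> \<U> \<Longrightarrow> A \<inter> B \<in> \<U>"
    and ultrafilter_on_Diff: "A \<subseteq> Y \<Longrightarrow> A \<notin> \<U> \<Longrightarrow> Y - A \<in> \<U>"
  using assms unfolding ultrafilter_on_def by (blast, simp, simp, simp, metis)

text \<open>Maximality of ultrafilters: a set in \<open>\<V>\<close> but not in \<open>\<U>\<close>
  would have its complement in \<open>\<U>\<close>, hence in \<open>\<V>\<close>.\<close>

lemma ultrafilter_on_subset_eq:
  assumes "ultrafilter_on Y \<U>" and "ultrafilter_on Y \<V>" and "\<U> \<subseteq> \<V>"
  shows "\<U> = \<V>"
proof
  show "\<V> \<subseteq> \<U>"
  proof
    fix A assume A: "A \<in> \<V>"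
    then have "A \<subseteq> Y" using assms(2) ultrafilter_on_subset by blast
    show "A \<in> \<U>"
    proof (rule ccontr)
      assume "A \<notin> \<U>"
      then have "Y - A \<in> \<V>" using \<open>A \<subseteq> Y\<close> assms ultrafilter_on_Diff by blast
      then have "A \<inter> (Y - A) \<in> \<V>" using A ultrafilter_on_Int[OF assms(2)] by blast
      then show False using ultrafilter_on_nonempty[OF assms(2)] by simp
    qed
  qed
qed (fact assms(3))

text \<open>The factor \<open>Y\<close> covers the empty family, whose intersection is the whole
  type.\<close>

lemma ultrafilter_on_finite_Inter:
  assumes "ultrafilter_on Y \<U>" and "finite \<A>" and "\<A> \<subseteq> \<U>"
  shows "Y \<inter> \<Inter>\<A> \<in> \<U>"
  using assms(2,3)
proof (induction \<A>)
  case empty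
  then show ?case using ultrafilter_on_top[OF assms(1)] by simp
next
  case (insert A \<A>)
  then have "A \<inter> (Y \<inter> \<Inter>\<A>) \<in> \<U>" using ultrafilter_on_Int[OF assms(1)] by blast
  then show ?case by (simp add: Int_left_commute)
qed

text \<open>Otherwise the complements of all parts would belong to \<open>\<U>\<close>, and so would
  their intersection, which is empty because the parts cover \<open>Y\<close>.\<close>

lemma ultrafilter_on_finite_partition:
  assumes \<U>: "ultrafilter_on Y \<U>" and "finite P" and P: "partition_on Y P"
  obtains A where "A \<in> P" "A \<in> \<U>"
proof (rule ccontr)
  assume neg: "\<not> thesis"
  have "A \<subseteq> Y" if "A \<in> P" for A
    using P that unfolding partition_on_def by blast
  then have "(\<lambda>A. Y - A) ` P \<subseteq> \<U>"
    using neg that ultrafilter_on_Diff[OF \<U>] by blast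
  then have "Y \<inter> \<Inter>((\<lambda>A. Y - A) ` P) \<in> \<U>"
    using ultrafilter_on_finite_Inter[OF \<U>] \<open>finite P\<close> by blast
  moreover have "Y \<inter> \<Inter>((\<lambda>A. Y - A) ` P) = {}"
    using P unfolding partition_on_def by blast
  ultimately show False using ultrafilter_on_nonempty[OF \<U>] by simp
qed

section \<open>Bounded sets in a superstructure\<close>

locale nonstandard =
  fixes elts :: "'v \<Rightarrow> 'v set" and X :: "'v set" and star :: "'v \<Rightarrow> 'v"
  assumes model: "nonstandard_model elts X star"
begin

text \<open>These are exactly the HOL sets that occur as extensions: every subset of a level is one,
  and \<open>bounded_elts\<close> gives the converse.\<close>

definition bounded :: "'v set \<Rightarrow> bool" where
  "bounded A \<longleftrightarrow> (\<exists>n. A \<subseteq> level elts X n)"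

lemma level_mono: "i \<le> j \<Longrightarrow> level elts X i \<subseteq> level elts X j"
  by (rule lift_Suc_mono_le) auto

lemma in_some_level: "\<exists>n. a \<in> level elts X n"
  using model unfolding nonstandard_model_def superstructure_def by blast

lemma bounded_subset: "bounded B \<Longrightarrow> A \<subseteq> B \<Longrightarrow> bounded A"
  unfolding bounded_def by blast

lemma bounded_Un:
  assumes "bounded A" and "bounded B"
  shows "bounded (A \<union> B)"
proof -
  obtain i j where "A \<subseteq> level elts X i" "B \<subseteq> level elts X j"
    using assms unfolding bounded_def by blast
  then have "A \<union> B \<subseteq> level elts X (max i j)"
    using level_mono[of i "max i j"] level_mono[of j "max i j"] by auto
  then show ?thesis unfolding bounded_def by blast
qed

lemma bounded_finite: "finite A \<Longrightarrow> bounded A"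
proof (induction A rule: finite_induct)
  case empty
  then show ?case unfolding bounded_def by blast
next
  case (insert a A)
  have "bounded {a}" using in_some_level unfolding bounded_def by blast
  with insert show ?case using bounded_Un[of "{a}" A] by simp
qed

lemma bounded_elts: "bounded (elts a)"
proof -
  have "a \<in> level elts X n \<Longrightarrow> bounded (elts a)" for n
  proof (induction n)
    case 0
    then have "elts a = {}"
      using model unfolding nonstandard_model_def superstructure_def by simp
    then show ?case unfolding bounded_def by simp
  next
    case (Suc n)
    then show ?case unfolding bounded_def by auto
  qed
  then show ?thesis using in_some_level by blast
qed

text \<open>Justifies the definite description in \<open>vset\<close>. All atoms have empty
  extension, so uniqueness rests on injectivity of \<open>elts\<close> outside
  \<open>X\<close>.\<close>

lemma vset_properties:
  assumes "bounded A"
  shows "vset elts X A \<notin> X \<and> elts (vset elts X A) = A"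
proof -
  obtain a where a: "a \<notin> X \<and> elts a = A"
    using assms model unfolding bounded_def nonstandard_model_def superstructure_def by blast
  moreover have "b = a" if "b \<notin> X \<and> elts b = A" for b
    using that a model unfolding nonstandard_model_def superstructure_def
    by (metis ComplI inj_onD)
  ultimately show ?thesis
    unfolding vset_def by (rule theI[of "\<lambda>a. a \<notin> X \<and> elts a = A"])
qed

lemma elts_vset: "bounded A \<Longrightarrow> elts (vset elts X A) = A"
  using vset_properties by blast

lemma elts_vset_subset: "A \<subseteq> elts Y \<Longrightarrow> elts (vset elts X A) = A"
  using elts_vset bounded_subset bounded_elts by blast

lemma vset_eq_iff: "bounded A \<Longrightarrow> bounded B \<Longrightarrow> vset elts X A = vset elts X B \<longleftrightarrow> A = B"
  by (metis elts_vset)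

lemma opair_eq_iff: "opair elts X a b = opair elts X c d \<longleftrightarrow> a = c \<and> b = d"
  by (auto simp: opair_def vset_eq_iff bounded_finite doubleton_eq_iff)

lemma vset_in_level:
  assumes "A \<subseteq> level elts X n"
  shows "vset elts X A \<in> level elts X (Suc n)"
  using assms vset_properties[of A] unfolding bounded_def by auto

lemma opair_in_level:
  assumes "a \<in> level elts X n" and "b \<in> level elts X n"
  shows "opair elts X a b \<in> level elts X (Suc (Suc n))"
  unfolding opair_def using assms by (intro vset_in_level) (simp del: level.simps add: vset_in_level)

lemma eval_tuple_tm_eq_iff:
  "eval elts X e (tuple_tm c xs) = eval elts X e' (tuple_tm c xs) \<longleftrightarrow> (\<forall>x\<in>set xs. e x = e' x)"
  by (induction xs) (auto simp: opair_eq_iff)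

text \<open>Each pairing climbs two levels, so codes of tuples of a fixed length stay within one
  level and their set has a \<open>vset\<close>.\<close>

lemma bounded_tuples:
  assumes "bounded A"
  shows "bounded {eval elts X e (tuple_tm c xs) | e. \<forall>x\<in>set xs. e x \<in> A}"
proof (induction xs)
  case Nil
  have "{eval elts X e (tuple_tm c []) | e. \<forall>x\<in>set []. e x \<in> A} = {c}" by auto
  then show ?case using bounded_finite by simp
next
  case (Cons x xs)
  let ?T = "{eval elts X e (tuple_tm c xs) | e. \<forall>x\<in>set xs. e x \<in> A}"
  obtain n where n: "A \<union> ?T \<subseteq> level elts X n"
    using bounded_Un[OF assms Cons.IH] unfolding bounded_def by blast
  have "{eval elts X e (tuple_tm c (x # xs)) | e. \<forall>x\<in>set (x # xs). e x \<in> A}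
      \<subseteq> level elts X (Suc (Suc n))"
  proof clarify
    fix e assume e: "\<forall>x\<in>set (x # xs). e x \<in> A"
    then have "e x \<in> level elts X n" "eval elts X e (tuple_tm c xs) \<in> level elts X n"
      using n by auto
    then show "eval elts X e (tuple_tm c (x # xs)) \<in> level elts X (Suc (Suc n))"
      using opair_in_level by (simp del: level.simps)
  qed
  then show ?case unfolding bounded_def by blast
qed

section \<open>Consequences of transfer\<close>

lemma transferD: "sat elts X e \<psi> \<longleftrightarrow> sat elts X (star \<circ> e) (map_fm star \<psi>)"
  using model unfolding nonstandard_model_def transfer_def by blast

text \<open>Quantified over \<open>a\<close>, the inclusion is a closed bounded formula, so the
  assignment is immaterial. Unions and the empty set are treated likewise below.\<close>

lemma star_Int_subset:
  assumes "elts a \<inter> elts b \<subseteq> elts c"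
  shows "elts (star a) \<inter> elts (star b) \<subseteq> elts (star c)"
  using assms transferD[of undefined "BAll 0 (Const a) (Imp (Mem (Var 0) (Const b)) (Mem (Var 0) (Const c)))"]
  by auto

lemma star_subset: "elts a \<subseteq> elts b \<Longrightarrow> elts (star a) \<subseteq> elts (star b)"
  using star_Int_subset[of a a b] by simp

lemma star_subset_Un:
  assumes "elts a \<subseteq> elts b \<union> elts c"
  shows "elts (star a) \<subseteq> elts (star b) \<union> elts (star c)"
  using assms transferD[of undefined "BAll 0 (Const a) (Disj (Mem (Var 0) (Const b)) (Mem (Var 0) (Const c)))"]
  by auto

lemma star_empty:
  assumes "elts a = {}"
  shows "elts (star a) = {}"
  using assms transferD[of undefined "BAll 0 (Const a) (Neg (Equ (Var 0) (Var 0)))"] by auto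

text \<open>If \<open>Y\<close> is an atom, \<open>vset elts X (elts Y)\<close> differs from
  \<open>Y\<close>, so the claim concerns extensions and follows from the two inclusions.\<close>

lemma star_vset_elts: "elts (star (vset elts X (elts Y))) = elts (star Y)"
  by (intro equalityI star_subset) (simp_all add: elts_vset bounded_elts)

text \<open>Each ultrafilter axiom reflects a transferred relation between sets; for maximality it
  is that \<open>A\<close> and its complement cover \<open>Y\<close>.\<close>

lemma ultrafilter_on_generated_ultrafilter:
  assumes \<alpha>: "\<alpha> \<in> elts (star Y)"
  shows "ultrafilter_on (elts Y) (generated_ultrafilter elts X star Y \<alpha>)"
  unfolding ultrafilter_on_def generated_ultrafilter_def
proof (intro conjI ballI allI impI; (elim conjE)?)
  show "elts Y \<in> {A. A \<subseteq> elts Y \<and> \<alpha> \<in> elts (star (vset elts X A))}"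
    using \<alpha> star_vset_elts by simp
  show "{} \<notin> {A. A \<subseteq> elts Y \<and> \<alpha> \<in> elts (star (vset elts X A))}"
    using star_empty[of "vset elts X {}"] by (simp add: elts_vset bounded_finite)
next
  fix A B
  assume A: "A \<in> {A. A \<subseteq> elts Y \<and> \<alpha> \<in> elts (star (vset elts X A))}"
    and B: "B \<in> {A. A \<subseteq> elts Y \<and> \<alpha> \<in> elts (star (vset elts X A))}"
  have "A \<inter> B \<subseteq> elts Y" using A by blast
  then have "elts (vset elts X A) \<inter> elts (vset elts X B) \<subseteq> elts (vset elts X (A \<inter> B))"
    using A B elts_vset_subset[of A Y] elts_vset_subset[of B Y] elts_vset_subset[of "A \<inter> B" Y]
    by simp
  then show "A \<inter> B \<in> {A. A \<subseteq> elts Y \<and> \<alpha> \<in> elts (star (vset elts X A))}"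
    using A B star_Int_subset by blast
next
  fix A B
  assume A: "A \<in> {A. A \<subseteq> elts Y \<and> \<alpha> \<in> elts (star (vset elts X A))}"
    and B: "A \<subseteq> B" "B \<subseteq> elts Y"
  then have "elts (vset elts X A) \<subseteq> elts (vset elts X B)"
    using elts_vset_subset[of A Y] elts_vset_subset[of B Y] by simp
  then show "B \<in> {A. A \<subseteq> elts Y \<and> \<alpha> \<in> elts (star (vset elts X A))}"
    using A B star_subset by blast
next
  fix A assume A: "A \<subseteq> elts Y"
  have "elts Y \<subseteq> elts (vset elts X A) \<union> elts (vset elts X (elts Y - A))"
    using A elts_vset_subset[of "elts Y - A" Y] by (auto simp: elts_vset_subset)
  then show "A \<in> {A. A \<subseteq> elts Y \<and> \<alpha> \<in> elts (star (vset elts X A))} \<or>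
      elts Y - A \<in> {A. A \<subseteq> elts Y \<and> \<alpha> \<in> elts (star (vset elts X A))}"
    using A \<alpha> star_subset_Un by blast
qed blast

text \<open>Transfer of the bounded formula \<open>bex_list\<close>; by the hypothesis on
  \<open>\<psi>\<close> it is closed, so no assignment matters on either side.\<close>

lemma models_star_iff:
  assumes "free_vars \<psi> \<subseteq> set xs"
  shows "models elts X (elts S) xs \<psi> \<longleftrightarrow> models elts X (elts (star S)) xs (map_fm star \<psi>)"
proof -
  have "free_vars (map_fm star \<psi>) \<subseteq> set xs" using assms by (simp add: free_vars_map)
  moreover have "sat elts X e (bex_list xs (Const S) \<psi>) \<longleftrightarrow>
      sat elts X (star \<circ> e) (bex_list xs (Const (star S)) (map_fm star \<psi>))" for e
    using transferD[of e "bex_list xs (Const S) \<psi>"] by (simp add: map_bex_list)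
  ultimately show ?thesis using assms models_iff_sat_bex_list by metis
qed

section \<open>Enlarging and coded tuples\<close>

lemma enlarging_family:
  fixes \<kappa> :: "'k rel" and B :: "'i \<Rightarrow> 'v set"
  assumes enl: "enlarging elts star \<kappa>" and card: "|I| <o \<kappa>"
    and bounded: "\<And>i. i \<in> I \<Longrightarrow> bounded (B i)"
    and fip: "\<And>J. finite J \<Longrightarrow> J \<subseteq> I \<Longrightarrow> \<exists>a. \<forall>i\<in>J. a \<in> B i"
  obtains a where "\<And>i. i \<in> I \<Longrightarrow> a \<in> elts (star (vset elts X (B i)))"
proof -
  let ?F = "(\<lambda>i. vset elts X (B i)) ` I"
  have "|?F| <o \<kappa>"
    using card card_of_image ordLeq_ordLess_trans by blast
  moreover have "\<exists>a. \<forall>A\<in>G. a \<in> elts A" if G: "G \<subseteq> ?F" "finite G" for G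
  proof -
    \<comment> \<open>A finite set of codes comes from finitely many indices, where
      \<open>fip\<close> applies.\<close>
    obtain J where J: "J \<subseteq> I" "finite J" "G = (\<lambda>i. vset elts X (B i)) ` J"
      using finite_subset_image[OF G(2,1)] by blast
    then obtain a where "\<forall>i\<in>J. a \<in> B i" using fip by blast
    then have "\<forall>A\<in>G. a \<in> elts A" using J bounded by (auto simp: elts_vset)
    then show ?thesis ..
  qed
  ultimately obtain a where "\<forall>A\<in>?F. a \<in> elts (star A)"
    using enl unfolding enlarging_def by blast
  then show thesis using that by blast
qed

text \<open>That every element of the coded set is the code of a tuple from \<open>A\<close>
  satisfying \<open>\<psi>\<close> is a bounded statement, so it transfers and decodes the elements
  of the star extension.\<close>

lemma star_tuples:
  assumes \<psi>: "free_vars \<psi> \<subseteq> set xs" and A: "A \<subseteq> elts Y"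
    and t: "t \<in> elts (star (vset elts X
      {eval elts X e (tuple_tm c xs) | e. (\<forall>x\<in>set xs. e x \<in> A) \<and> sat elts X e \<psi>}))"
      (is "_ \<in> elts (star ?B)")
  shows "\<exists>\<alpha>. t = eval elts X \<alpha> (tuple_tm (star c) xs) \<and>
    (\<forall>x\<in>set xs. \<alpha> x \<in> elts (star (vset elts X A))) \<and> sat elts X \<alpha> (map_fm star \<psi>)"
proof -
  \<comment> \<open>\<open>z\<close> stands for the element to be decoded and must survive the
    quantifiers over \<open>xs\<close>.\<close>
  obtain z where z: "z \<notin> set xs" using ex_new_if_finite[OF infinite_UNIV_nat, of "set xs"] by auto
  let ?\<theta> = "BAll z (Const ?B)
    (bex_list xs (Const (vset elts X A)) (Conj (Equ (Var z) (tuple_tm c xs)) \<psi>))"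
  have bA: "bounded A" using A bounded_subset bounded_elts by blast
  have "bounded {eval elts X e (tuple_tm c xs) | e. (\<forall>x\<in>set xs. e x \<in> A) \<and> sat elts X e \<psi>}"
    by (rule bounded_subset[OF bounded_tuples[OF bA]]) auto
  then have B: "elts ?B =
      {eval elts X e (tuple_tm c xs) | e. (\<forall>x\<in>set xs. e x \<in> A) \<and> sat elts X e \<psi>}"
    by (rule elts_vset)
  fix e0 :: "nat \<Rightarrow> 'v"
  have "sat elts X e0 ?\<theta>"
  proof (simp only: sat.simps eval.simps, rule ballI)
    fix b assume "b \<in> elts ?B"
    then obtain e where e: "b = eval elts X e (tuple_tm c xs)" "\<forall>x\<in>set xs. e x \<in> A"
      "sat elts X e \<psi>" unfolding B by blast
    let ?e = "override_on (e0(z := b)) e (set xs)"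
    have "?e z = b" using z by simp
    moreover have "eval elts X ?e (tuple_tm c xs) = b"
      unfolding e(1) by (rule eval_cong) (simp add: tm_vars_tuple_tm)
    moreover have "sat elts X ?e \<psi>"
      using e(3) \<psi> by (subst sat_cong[of _ _ e]) (auto simp: override_on_def)
    ultimately show "sat elts X (e0(z := b)) (bex_list xs (Const (vset elts X A))
        (Conj (Equ (Var z) (tuple_tm c xs)) \<psi>))"
      unfolding sat_bex_list using e(2)
      by (intro exI[of _ ?e]) (auto simp: elts_vset[OF bA])
  qed
  then have "sat elts X (star \<circ> e0) (map_fm star ?\<theta>)" using transferD by blast
  \<comment> \<open>The transferred universal quantifier over \<open>z\<close> is instantiated with
    \<open>t\<close>.\<close>
  then have "sat elts X ((star \<circ> e0)(z := t)) (bex_list xs (Const (star (vset elts X A)))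
      (Conj (Equ (Var z) (tuple_tm (star c) xs)) (map_fm star \<psi>)))"
    using t by (simp add: map_bex_list map_tuple_tm)
  then show ?thesis
    unfolding sat_bex_list using z by auto
qed

section \<open>Ultrafilters, star solutions and partition regularity\<close>

lemma ultrafilter_of_star_solution:
  assumes \<psi>: "free_vars \<psi> \<subseteq> set xs" and "xs \<noteq> []"
    and \<alpha>Y: "\<forall>x\<in>set xs. \<alpha> x \<in> elts (star Y)"
    and gen: "\<forall>x\<in>set xs. \<forall>x'\<in>set xs. generated_ultrafilter elts X star Y (\<alpha> x) =
      generated_ultrafilter elts X star Y (\<alpha> x')"
    and sat: "sat elts X \<alpha> (map_fm star \<psi>)"
  shows "\<exists>\<U>. ultrafilter_on (elts Y) \<U> \<and> (\<forall>A\<in>\<U>. models elts X A xs \<psi>)"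
proof (intro exI conjI ballI)
  \<comment> \<open>All coordinates generate the same ultrafilter; the first one represents
    it.\<close>
  have hd: "hd xs \<in> set xs" using \<open>xs \<noteq> []\<close> by simp
  then show "ultrafilter_on (elts Y) (generated_ultrafilter elts X star Y (\<alpha> (hd xs)))"
    using \<alpha>Y ultrafilter_on_generated_ultrafilter by blast
  fix A assume A: "A \<in> generated_ultrafilter elts X star Y (\<alpha> (hd xs))"
  have "\<alpha> x \<in> elts (star (vset elts X A))" if "x \<in> set xs" for x
  proof -
    have "A \<in> generated_ultrafilter elts X star Y (\<alpha> x)" using A gen hd that by blast
    then show ?thesis unfolding generated_ultrafilter_def by blast
  qed
  then have "models elts X (elts (star (vset elts X A))) xs (map_fm star \<psi>)"
    using sat unfolding models_def by blast
  then have "models elts X (elts (vset elts X A)) xs \<psi>" using models_star_iff[OF \<psi>] by blast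
  moreover have "A \<subseteq> elts Y" using A unfolding generated_ultrafilter_def by blast
  ultimately show "models elts X A xs \<psi>" by (simp add: elts_vset_subset)
qed

lemma star_solution_of_ultrafilter:
  fixes \<kappa> :: "'k rel"
  assumes enl: "enlarging elts star \<kappa>" and card: "|Pow (elts Y)| <o \<kappa>"
    and \<psi>: "free_vars \<psi> \<subseteq> set xs"
    and \<U>: "ultrafilter_on (elts Y) \<U>" and mod: "\<forall>A\<in>\<U>. models elts X A xs \<psi>"
  shows "\<exists>\<alpha>. (\<forall>x\<in>set xs. \<alpha> x \<in> elts (star Y)) \<and>
    (\<forall>x\<in>set xs. \<forall>x'\<in>set xs. generated_ultrafilter elts X star Y (\<alpha> x) =
      generated_ultrafilter elts X star Y (\<alpha> x')) \<and>
    sat elts X \<alpha> (map_fm star \<psi>)"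
proof -
  define B where "B A =
    {eval elts X e (tuple_tm Y xs) | e. (\<forall>x\<in>set xs. e x \<in> A) \<and> sat elts X e \<psi>}" for A
  have sub: "\<U> \<subseteq> Pow (elts Y)" and top: "elts Y \<in> \<U>"
    using ultrafilter_on_subset[OF \<U>] ultrafilter_on_top[OF \<U>] by auto
  have "|\<U>| <o \<kappa>" using card_of_mono1[OF sub] card by (rule ordLeq_ordLess_trans)
  moreover have "bounded (B A)" if "A \<in> \<U>" for A
  proof -
    have "B A \<subseteq> {eval elts X e (tuple_tm Y xs) | e. \<forall>x\<in>set xs. e x \<in> elts Y}"
      unfolding B_def using that sub by blast
    then show ?thesis using bounded_tuples[OF bounded_elts] bounded_subset by blast
  qed
  moreover have "\<exists>a. \<forall>A\<in>J. a \<in> B A" if "finite J" "J \<subseteq> \<U>" for J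
  proof -
    \<comment> \<open>A single solution inside this intersection lies in \<open>B A\<close> for all
      \<open>A\<close> in \<open>J\<close> simultaneously.\<close>
    have "elts Y \<inter> \<Inter>J \<in> \<U>" using ultrafilter_on_finite_Inter[OF \<U> that] .
    then obtain e where "\<forall>x\<in>set xs. e x \<in> elts Y \<inter> \<Inter>J" "sat elts X e \<psi>"
      using mod unfolding models_def by blast
    then have "\<forall>A\<in>J. eval elts X e (tuple_tm Y xs) \<in> B A" unfolding B_def by blast
    then show ?thesis ..
  qed
  ultimately obtain t where t: "\<And>A. A \<in> \<U> \<Longrightarrow> t \<in> elts (star (vset elts X (B A)))"
    using enlarging_family[OF enl, of \<U> B] by blast
  \<comment> \<open>Here the decoding \<open>\<alpha>\<close> still depends on \<open>A\<close>; one
    is then fixed, namely that for \<open>elts Y\<close>.\<close>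
  have sol: "\<exists>\<alpha>. t = eval elts X \<alpha> (tuple_tm (star Y) xs) \<and>
      (\<forall>x\<in>set xs. \<alpha> x \<in> elts (star (vset elts X A))) \<and> sat elts X \<alpha> (map_fm star \<psi>)"
    if "A \<in> \<U>" for A
    using star_tuples[OF \<psi>, of A Y t Y] t[OF that] that sub unfolding B_def by blast
  then obtain \<alpha> where \<alpha>: "t = eval elts X \<alpha> (tuple_tm (star Y) xs)"
    "\<forall>x\<in>set xs. \<alpha> x \<in> elts (star (vset elts X (elts Y)))" "sat elts X \<alpha> (map_fm star \<psi>)"
    using top by blast
  then have \<alpha>Y: "\<forall>x\<in>set xs. \<alpha> x \<in> elts (star Y)" by (simp add: star_vset_elts)
  have "\<U> = generated_ultrafilter elts X star Y (\<alpha> x)" if x: "x \<in> set xs" for x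
  \<comment> \<open>By maximality of ultrafilters one inclusion is enough.\<close>
  proof (rule ultrafilter_on_subset_eq[OF \<U>])
    show "ultrafilter_on (elts Y) (generated_ultrafilter elts X star Y (\<alpha> x))"
      using \<alpha>Y x ultrafilter_on_generated_ultrafilter by blast
    show "\<U> \<subseteq> generated_ultrafilter elts X star Y (\<alpha> x)"
    proof
      fix A assume A: "A \<in> \<U>"
      then obtain \<beta> where \<beta>: "t = eval elts X \<beta> (tuple_tm (star Y) xs)"
        "\<forall>x\<in>set xs. \<beta> x \<in> elts (star (vset elts X A))" using sol by blast
      \<comment> \<open>Both assignments decode the same \<open>t\<close>, and coding is injective
        on \<open>xs\<close>.\<close>
      then have "\<alpha> x = \<beta> x" using \<alpha>(1) x eval_tuple_tm_eq_iff by metis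
      then show "A \<in> generated_ultrafilter elts X star Y (\<alpha> x)"
        using \<beta>(2) x A sub unfolding generated_ultrafilter_def by auto
    qed
  qed
  then show ?thesis using \<alpha>Y \<alpha>(3) by blast
qed

lemma ultrafilter_of_partition_regular:
  fixes \<kappa> :: "'k rel"
  assumes enl: "enlarging elts star \<kappa>" and card: "|Pow (elts Y)| <o \<kappa>" and "xs \<noteq> []"
    and pr: "partition_regular elts X Y xs \<psi>"
  shows "\<exists>\<U>. ultrafilter_on (elts Y) \<U> \<and> (\<forall>A\<in>\<U>. models elts X A xs \<psi>)"
proof -
  define N where "N = {A. A \<subseteq> elts Y \<and> \<not> models elts X A xs \<psi>}"
  have "N \<subseteq> Pow (elts Y)" unfolding N_def by blast
  then have "|N| <o \<kappa>" using card card_of_mono1 ordLeq_ordLess_trans by blast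
  moreover have "bounded (elts Y - A)" for A
    using bounded_subset[OF bounded_elts, of "elts Y - A" Y] by blast
  moreover have "\<exists>a. \<forall>A\<in>J. a \<in> elts Y - A" if J: "finite J" "J \<subseteq> N" for J
  proof -
    \<comment> \<open>The atoms of the Boolean algebra generated by \<open>J\<close> on
      \<open>elts Y\<close>: two points share a part iff they lie in the same members of
      \<open>J\<close>.\<close>
    define P where "P = (\<lambda>s. {y \<in> elts Y. {A \<in> J. y \<in> A} = s}) ` (\<lambda>y. {A \<in> J. y \<in> A}) ` elts Y"
    have "(\<lambda>y. {A \<in> J. y \<in> A}) ` elts Y \<subseteq> Pow J" by blast
    then have "finite P"
      unfolding P_def using J(1) finite_subset by blast
    moreover have "partition_on (elts Y) P" unfolding P_def by (rule partition_on_fibres)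
    ultimately obtain C where C: "C \<in> P" "models elts X C xs \<psi>"
      using pr unfolding partition_regular_def by blast
    then obtain y where y: "y \<in> elts Y" "C = {z \<in> elts Y. {A \<in> J. z \<in> A} = {A \<in> J. y \<in> A}}"
      unfolding P_def by blast
    \<comment> \<open>A member of \<open>J\<close> containing \<open>y\<close> contains all of
      \<open>C\<close>, so it would model the formula by monotonicity.\<close>
    have "y \<notin> A" if A: "A \<in> J" for A
    proof
      assume "y \<in> A"
      then have "C \<subseteq> A" using y A by blast
      then show False using models_mono C(2) A J(2) unfolding N_def by blast
    qed
    then show ?thesis using y(1) by blast
  qed
  ultimately obtain \<alpha> where \<alpha>: "\<And>A. A \<in> N \<Longrightarrow> \<alpha> \<in> elts (star (vset elts X (elts Y - A)))"
    using enlarging_family[OF enl, of N "\<lambda>A. elts Y - A"] by blast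
  \<comment> \<open>With at least one variable in \<open>xs\<close> the empty set models nothing;
    its complement \<open>elts Y\<close> is then in the family, which places \<open>\<alpha>\<close>
    in the star of \<open>Y\<close>.\<close>
  have "{} \<in> N" using \<open>xs \<noteq> []\<close> unfolding N_def models_def by auto
  then have "\<alpha> \<in> elts (star Y)" using \<alpha> star_vset_elts by fastforce
  then have U: "ultrafilter_on (elts Y) (generated_ultrafilter elts X star Y \<alpha>)" (is "ultrafilter_on _ ?U")
    by (rule ultrafilter_on_generated_ultrafilter)
  have "models elts X A xs \<psi>" if A: "A \<in> ?U" for A
  proof (rule ccontr)
    assume "\<not> models elts X A xs \<psi>"
    then have "A \<in> N" using A unfolding N_def generated_ultrafilter_def by blast
    then have "elts Y - A \<in> ?U" using \<alpha> unfolding generated_ultrafilter_def by blast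
    then have "A \<inter> (elts Y - A) \<in> ?U" using A ultrafilter_on_Int[OF U] by blast
    then show False using ultrafilter_on_nonempty[OF U] by simp
  qed
  then show ?thesis using U by blast
qed

lemma partition_regular_of_ultrafilter:
  assumes "ultrafilter_on (elts Y) \<U>" and "\<forall>A\<in>\<U>. models elts X A xs \<psi>"
  shows "partition_regular elts X Y xs \<psi>"
  unfolding partition_regular_def
  using assms ultrafilter_on_finite_partition by metis

end

theorem theorem5p4:
  fixes elts :: "'v \<Rightarrow> 'v set" and X :: "'v set" and star :: "'v \<Rightarrow> 'v"
    and \<kappa> :: "'k rel" and Y :: 'v
    and \<phi> :: "'v fm" and xs ys :: "nat list" and Qs :: "quant list" and Ss :: "'v list"
    and n m :: nat
  assumes "nonstandard_model elts X star"
    and "Card_order \<kappa>" and "|Pow (Pow (elts Y))| <o \<kappa>" and "enlarging elts star \<kappa>"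
    and "length xs = n" and "n \<ge> 1"
    and "length ys = m" and "length Qs = m" and "length Ss = m"
    and "distinct (xs @ ys)" and "fm_vars \<phi> = set xs \<union> set ys" and "totally_open \<phi>"
  shows
    "(partition_regular elts X Y xs (quant_prefix Qs ys Ss \<phi>) \<longleftrightarrow>
       (\<exists>\<alpha>. (\<forall>x\<in>set xs. \<alpha> x \<in> elts (star Y)) \<and>
            (\<forall>x\<in>set xs. \<forall>x'\<in>set xs.
               generated_ultrafilter elts X star Y (\<alpha> x) =
               generated_ultrafilter elts X star Y (\<alpha> x')) \<and>
            sat elts X \<alpha> (quant_prefix Qs ys (map star Ss) (map_fm star \<phi>)))) \<and>
     (partition_regular elts X Y xs (quant_prefix Qs ys Ss \<phi>) \<longleftrightarrow>
       (\<exists>\<U>. ultrafilter_on (elts Y) \<U> \<and>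
            (\<forall>A\<in>\<U>. models elts X A xs (quant_prefix Qs ys Ss \<phi>))))"
proof -
  interpret nonstandard elts X star by unfold_locales (fact assms(1))
  let ?\<psi> = "quant_prefix Qs ys Ss \<phi>"
  have \<psi>: "free_vars ?\<psi> \<subseteq> set xs"
    using assms(7-9,11) free_vars_subset_fm_vars[of \<phi>] by (auto simp: free_vars_quant_prefix)
  have star: "map_fm star ?\<psi> = quant_prefix Qs ys (map star Ss) (map_fm star \<phi>)"
    by (rule map_quant_prefix)
  have "xs \<noteq> []" using assms(5,6) by auto
  \<comment> \<open>Both uses of enlarging have families indexed by subsets of
    \<open>elts Y\<close>.\<close>
  have card: "|Pow (elts Y)| <o \<kappa>"
    using card_of_Pow assms(3) ordLess_transitive by blast
  show ?thesis
    unfolding star[symmetric]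
  \<comment> \<open>Passing between partition regularity and star solutions goes through an
    ultrafilter in both directions.\<close>
  proof (intro conjI iffI)
    assume "partition_regular elts X Y xs ?\<psi>"
    then obtain \<U> where "ultrafilter_on (elts Y) \<U>" "\<forall>A\<in>\<U>. models elts X A xs ?\<psi>"
      using ultrafilter_of_partition_regular[OF assms(4) card \<open>xs \<noteq> []\<close>] by blast
    then show "\<exists>\<alpha>. (\<forall>x\<in>set xs. \<alpha> x \<in> elts (star Y)) \<and>
        (\<forall>x\<in>set xs. \<forall>x'\<in>set xs. generated_ultrafilter elts X star Y (\<alpha> x) =
          generated_ultrafilter elts X star Y (\<alpha> x')) \<and>
        sat elts X \<alpha> (map_fm star ?\<psi>)"
      by (rule star_solution_of_ultrafilter[OF assms(4) card \<psi>])
  next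
    assume "\<exists>\<alpha>. (\<forall>x\<in>set xs. \<alpha> x \<in> elts (star Y)) \<and>
        (\<forall>x\<in>set xs. \<forall>x'\<in>set xs. generated_ultrafilter elts X star Y (\<alpha> x) =
          generated_ultrafilter elts X star Y (\<alpha> x')) \<and>
        sat elts X \<alpha> (map_fm star ?\<psi>)"
    then have "\<exists>\<U>. ultrafilter_on (elts Y) \<U> \<and> (\<forall>A\<in>\<U>. models elts X A xs ?\<psi>)"
      by (elim exE conjE) (rule ultrafilter_of_star_solution[OF \<psi> \<open>xs \<noteq> []\<close>])
    then show "partition_regular elts X Y xs ?\<psi>"
      by (elim exE conjE) (rule partition_regular_of_ultrafilter)
  next
    assume "partition_regular elts X Y xs ?\<psi>"
    then show "\<exists>\<U>. ultrafilter_on (elts Y) \<U> \<and> (\<forall>A\<in>\<U>. models elts X A xs ?\<psi>)"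
      by (rule ultrafilter_of_partition_regular[OF assms(4) card \<open>xs \<noteq> []\<close>])
  next
    assume "\<exists>\<U>. ultrafilter_on (elts Y) \<U> \<and> (\<forall>A\<in>\<U>. models elts X A xs ?\<psi>)"
    then show "partition_regular elts X Y xs ?\<psi>"
      by (elim exE conjE) (rule partition_regular_of_ultrafilter)
  qed
qed

end
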